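(* Let $I\subseteq\mathbb{R}_+$ be an interval with $\inf I=0$ and let $f\colon I\to\mathbb{R}$ be a twice differentiable function with nowhere vanishing first derivative. Define $p,q\in[-\infty,+\infty]$ by $$p:=\liminf_{t\to0}\chi_f(t)\qquad\text{and}\qquad q:=\limsup_{t\to0}\chi_f(t),\qquad\text{where }\chi_f(t):=\frac{t f''(t)}{f'(t)}+1 .$$ Then $\mathcal{P}_p\le(\mathcal{A}_f)_\#$ and $(\mathcal{A}_f)^\#\le\mathcal{P}_q$ (pointwise on $\bigcup_{n=1}^\infty\mathbb{R}_+^n\times W_n(\mathbb{R})$). In particular, if the limit $\lim_{t\to0}\chi_f(t)$ exists (in $[-\infty,+\infty]$), then $(\mathcal{A}_f)_\#=(\mathcal{A}_f)^\#=\mathcal{P}_p=\mathcal{P}_q$.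
   Context: $\mathbb{R}_+=(0,\infty)$. For $n\in\mathbb{N}$, $W_n(\mathbb{R})=\{(\lambda_1,\dots,\lambda_n)\in\mathbb{R}^n\mid\lambda_1,\dots,\lambda_n\ge0,\ \lambda_1+\dots+\lambda_n>0\}$. Weighted power means: for $p\in[-\infty,\infty]$, $n\in\mathbb{N}$, $x\in\mathbb{R}_+^n$, $\lambda\in W_n(\mathbb{R})$, $\mathcal{P}_p(x,\lambda)=\left(\frac{\lambda_1x_1^p+\cdots+\lambda_nx_n^p}{\lambda_1+\cdots+\lambda_n}\right)^{1/p}$ if $p\in\mathbb{R}\setminus\{0\}$; $\mathcal{P}_0(x,\lambda)=\left(x_1^{\lambda_1}\cdots x_n^{\lambda_n}\right)^{1/(\lambda_1+\cdots+\lambda_n)}$; $\mathcal{P}_{-\infty}(x,\lambda)=\min\{x_i\mid\lambda_i>0\}$; $\mathcal{P}_{+\infty}(x,\lambda)=\max\{x_i\mid\lambda_i>0\}$. Weighted quasiarithmetic mean: for a continuous strictly monotone $f\colon I\to\mathbb{R}$, $\mathcal{A}_f(x,\lambda)=f^{-1}\left(\frac{\lambda_1f(x_1)+\cdots+\lambda_nf(x_n)}{\lambda_1+\cdots+\lambda_n}\right)$ for $n\in\mathbb{N}$, $(x,\lambda)\in I^n\times W_n(\mathbb{R})$. Lower and upper (local) homogenization: for a function $\mathcal{M}\colon\bigcup_{n}I^n\times W_n(\mathbb{R})\to I$ (a weighted mean) with $I\subseteq\mathbb{R}_+$, $\inf I=0$, put, for $(x,\lambda)\in\mathbb{R}_+^n\times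 W_n(\mathbb{R})$, $\mathcal{M}_\#(x,\lambda)=\liminf_{t\to0}\frac1t\mathcal{M}(tx,\lambda)$ and $\mathcal{M}^\#(x,\lambda)=\limsup_{t\to0}\frac1t\mathcal{M}(tx,\lambda)$. All limits $t\to0$ are taken over positive $t$ (and $tx\in I^n$ for all small $t>0$). *)

theory Defs
  imports "HOL-Analysis.Analysis"
begin

text \<open>
  Points of the n-fold power of a set are lists of length n, so that a function on the union of
  all the sets \<open>I\<^sup>n \<times> W\<^sub>n\<close> is a single HOL function on pairs of lists, and n is an ordinary
  natural number. Values of such functions outside this union are irrelevant.
\<close>

definition tuples :: "real set \<Rightarrow> nat \<Rightarrow> real list set" where
  "tuples I n = {x. length x = n \<and> set x \<subseteq> I}"

definition weights :: "nat \<Rightarrow> real list set" where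
  "weights n = {w. length w = n \<and> (\<forall>l\<in>set w. 0 \<le> l) \<and> 0 < (\<Sum>i<n. w ! i)}"

definition mean_dom :: "real set \<Rightarrow> (real list \<times> real list) set" where
  "mean_dom I = (\<Union>n\<in>{1..}. tuples I n \<times> weights n)"

definition power_mean :: "ereal \<Rightarrow> real list \<Rightarrow> real list \<Rightarrow> real" where
  "power_mean p x w =
    (case p of
       ereal r \<Rightarrow>
         (if r = 0
          then (\<Prod>i<length x. (x ! i) powr (w ! i)) powr (1 / (\<Sum>i<length x. w ! i))
          else ((\<Sum>i<length x. w ! i * (x ! i) powr r) / (\<Sum>i<length x. w ! i)) powr (1 / r))
     | MInfty \<Rightarrow> Min {x ! i | i. i < length x \<and> w ! i > 0}
     | PInfty \<Rightarrow> Max {x ! i | i. i < length x \<and> w ! i > 0})"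

definition qa_mean :: "real set \<Rightarrow> (real \<Rightarrow> real) \<Rightarrow> real list \<Rightarrow> real list \<Rightarrow> real" where
  "qa_mean I f x w =
     the_inv_into I f ((\<Sum>i<length x. w ! i * f (x ! i)) / (\<Sum>i<length x. w ! i))"

text \<open>
  The lower and upper limits are taken in the extended reals. If \<open>I \<subseteq> {0<..}\<close> is an interval with
  infimum 0, then the scaled tuple has its entries in \<open>I\<close> for all sufficiently small positive t.
\<close>

definition lower_homog :: "(real list \<Rightarrow> real list \<Rightarrow> real) \<Rightarrow> real list \<Rightarrow> real list \<Rightarrow> ereal" where
  "lower_homog M x w = Liminf (at_right 0) (\<lambda>t. ereal (1 / t * M (map (\<lambda>a. t * a) x) w))"

definition upper_homog :: "(real list \<Rightarrow> real list \<Rightarrow> real) \<Rightarrow> real list \<Rightarrow> real list \<Rightarrow> ereal" where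
  "upper_homog M x w = Limsup (at_right 0) (\<lambda>t. ereal (1 / t * M (map (\<lambda>a. t * a) x) w))"

text \<open>The arguments are the first and the second derivative of the function in question.\<close>

definition chi :: "(real \<Rightarrow> real) \<Rightarrow> (real \<Rightarrow> real) \<Rightarrow> real \<Rightarrow> real" where
  "chi f' f'' t = t * f'' t / f' t + 1"

end

theory Submission
  imports Defs
begin

text \<open>
  Let \<open>g\<close> be the generator \<open>t powr r / r\<close> (or \<open>ln\<close>, if \<open>r = 0\<close>) of the power mean of exponent \<open>r\<close>,
  and let \<open>f\<close> be increasing. The derivative of \<open>f' / g'\<close> has the sign of \<open>\<chi>\<^sub>f - r\<close>. If
  \<open>\<chi>\<^sub>f \<ge> r\<close> on an interval \<open>(0, d)\<close>, then \<open>f\<close> is therefore convex with respect to \<open>g\<close> there, and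
  Jensen's inequality shows that \<open>\<A>\<^sub>f\<close> dominates the power mean of exponent \<open>r\<close> on tuples with entries
  in \<open>(0, d)\<close>. By homogeneity of power means this bound passes to the lower homogenization for every
  real \<open>r < p\<close>, and letting \<open>r\<close> tend to \<open>p\<close> gives the claim. The upper bound is dual.
\<close>

section \<open>Generators of the power means of finite exponent\<close>

text \<open>Dividing by \<open>r\<close> makes the generator increasing for negative
  \<open>r\<close> as well and gives the derivative \<open>t powr (r - 1)\<close> for every
  \<open>r\<close>, including 0.\<close>

definition pow_fun :: "real \<Rightarrow> real \<Rightarrow> real" where
  "pow_fun r t = (if r = 0 then ln t else t powr r / r)"

lemma pow_fun_deriv:
  assumes "0 < t"
  shows "(pow_fun r has_real_derivative t powr (r - 1)) (at t)"
proof (cases "r = 0")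
  case True
  have "((\<lambda>t. ln t) has_real_derivative t powr (r - 1)) (at t)"
    using assms True by (auto intro!: derivative_eq_intros simp: powr_minus divide_simps)
  then show ?thesis using True by (simp add: pow_fun_def[abs_def])
next
  case False
  have "((\<lambda>t. t powr r / r) has_real_derivative t powr (r - 1)) (at t)"
    using assms False by (auto intro!: derivative_eq_intros)
  then show ?thesis using False by (simp add: pow_fun_def[abs_def])
qed

lemma pow_fun_strict_mono: "strict_mono_on {0<..} (pow_fun r)"
proof (rule strict_mono_onI)
  fix a b :: real
  assume ab: "a \<in> {0<..}" "b \<in> {0<..}" "a < b"
  show "pow_fun r a < pow_fun r b"
  proof (rule DERIV_pos_imp_increasing[OF ab(3)])
    fix t assume "a \<le> t" "t \<le> b"
    then have t: "0 < t" using ab by simp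
    show "\<exists>D. (pow_fun r has_real_derivative D) (at t) \<and> 0 < D"
      by (rule exI[of _ "t powr (r - 1)"]) (use t pow_fun_deriv in simp)
  qed
qed

lemma pow_fun_continuous: "continuous_on {0<..} (pow_fun r)"
  by (rule DERIV_continuous_on[OF has_field_derivative_at_within[OF pow_fun_deriv]]) simp

section \<open>Weighted tuples and attained averages\<close>

lemma mean_domD:
  assumes "(x, w) \<in> mean_dom J"
  shows "length w = length x"
    and "i < length x \<Longrightarrow> x ! i \<in> J"
    and "i < length x \<Longrightarrow> 0 \<le> w ! i"
    and "0 < (\<Sum>i<length x. w ! i)"
proof -
  have *: "length w = length x" "set x \<subseteq> J" "\<forall>l\<in>set w. 0 \<le> l" "0 < (\<Sum>i<length x. w ! i)"
    using assms by (auto simp: mean_dom_def tuples_def weights_def)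
  then show "length w = length x" "0 < (\<Sum>i<length x. w ! i)" by simp_all
  show "i < length x \<Longrightarrow> x ! i \<in> J" "i < length x \<Longrightarrow> 0 \<le> w ! i"
    using * nth_mem[of i x] nth_mem[of i w] by auto
qed

lemma mean_dom_mono: "J \<subseteq> K \<Longrightarrow> mean_dom J \<subseteq> mean_dom K"
  unfolding mean_dom_def tuples_def by blast

text \<open>A positive total weight forces some positive weight. This makes the \<open>Min\<close>
  and \<open>Max\<close> in the power means of infinite exponent meaningful.\<close>

lemma mean_dom_support:
  assumes "(x, w) \<in> mean_dom J"
  defines "S \<equiv> {x ! i | i. i < length x \<and> w ! i > 0}"
  shows "finite S" and "S \<noteq> {}" and "S \<subseteq> J"
proof -
  show "finite S" by (simp add: S_def)
  show "S \<subseteq> J" using mean_domD[OF assms(1)] by (auto simp: S_def)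
  show "S \<noteq> {}"
  proof
    assume "S = {}"
    then have "w ! i \<le> 0" if "i < length x" for i
      using that not_less unfolding S_def by blast
    then have "(\<Sum>i<length x. w ! i) \<le> 0"
      by (intro sum_nonpos) auto
    then show False using mean_domD(4)[OF assms(1)] by simp
  qed
qed

text \<open>The weighted average of the values lies between \<open>f\<close> at the least and
  \<open>f\<close> at the greatest entry of positive weight, so the intermediate value theorem
  applies. Both power means and quasiarithmetic means are obtained from this balance point; the
  final bounds settle the exponents \<open>-\<infinity>\<close> and
  \<open>\<infinity>\<close>.\<close>

lemma average_attained:
  assumes J: "is_interval J" and f: "continuous_on J f" "strict_mono_on J f"
    and x: "(x, w) \<in> mean_dom J"
  obtains m where "m \<in> J" "f m * (\<Sum>i<length x. w ! i) = (\<Sum>i<length x. w ! i * f (x ! i))"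
    "power_mean (-\<infinity>) x w \<le> m" "m \<le> power_mean \<infinity> x w"
proof -
  define S where "S = {x ! i | i. i < length x \<and> w ! i > 0}"
  define W where "W = (\<Sum>i<length x. w ! i)"
  have W: "0 < W" using mean_domD(4)[OF x] by (simp add: W_def)
  have S: "finite S" "S \<noteq> {}" "S \<subseteq> J"
    using mean_dom_support[OF x] by (simp_all add: S_def)
  define a where "a = Min S"
  define c where "c = Max S"
  have ac: "a \<in> J" "c \<in> J" "a \<le> c"
    using S(3) Min_in[OF S(1,2)] Max_in[OF S(1,2)] Min_le[OF S(1)] unfolding a_def c_def by blast+
  have sub: "{a..c} \<subseteq> J"
    using J ac by (meson atLeastAtMost_iff mem_is_interval_1_I subsetI)
  \<comment> \<open>An entry of weight zero may lie outside \<open>{a..c}\<close>, so values of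
    \<open>f\<close> are compared only after multiplication by the weight.\<close>
  have bnd: "w ! i * f a \<le> w ! i * f (x ! i) \<and> w ! i * f (x ! i) \<le> w ! i * f c"
    if i: "i < length x" for i
  proof (cases "w ! i = 0")
    case False
    then have "x ! i \<in> S" using i mean_domD(3)[OF x i] by (auto simp: S_def)
    then have "a \<le> x ! i" "x ! i \<le> c" "x ! i \<in> J" using S by (auto simp: a_def c_def)
    then have "f a \<le> f (x ! i)" "f (x ! i) \<le> f c"
      using strict_mono_on_leD[OF f(2)] ac by auto
    then show ?thesis using mean_domD(3)[OF x i] by (simp add: mult_left_mono)
  qed auto
  have "f a * W \<le> (\<Sum>i<length x. w ! i * f (x ! i))" "(\<Sum>i<length x. w ! i * f (x ! i)) \<le> f c * W"
    using bnd by (auto simp: W_def sum_distrib_left mult.commute intro!: sum_mono)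
  then have "f a \<le> (\<Sum>i<length x. w ! i * f (x ! i)) / W"
    "(\<Sum>i<length x. w ! i * f (x ! i)) / W \<le> f c"
    using W by (auto simp: field_simps)
  then obtain m where m: "a \<le> m" "m \<le> c" "f m = (\<Sum>i<length x. w ! i * f (x ! i)) / W"
    using IVT'[of f a _ c] ac continuous_on_subset[OF f(1) sub] by blast
  show thesis
  proof
    show "m \<in> J" using m sub by auto
    show "f m * (\<Sum>i<length x. w ! i) = (\<Sum>i<length x. w ! i * f (x ! i))"
      using m W by (simp add: W_def)
    show "power_mean (-\<infinity>) x w \<le> m" "m \<le> power_mean \<infinity> x w"
      using m by (auto simp: power_mean_def a_def c_def S_def)
  qed
qed

section \<open>Finite power means as solutions of a balance equation\<close>

text \<open>Exponentiating (\<open>r = 0\<close>) or taking the power \<open>1 / r\<close> solves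
  the balance equation for \<open>m\<close>. Identities for power means thus reduce to checking that
  equation.\<close>

lemma power_mean_eqI:
  assumes x: "(x, w) \<in> mean_dom {0<..}" and m: "0 < m"
    and eq: "pow_fun r m * (\<Sum>i<length x. w ! i) = (\<Sum>i<length x. w ! i * pow_fun r (x ! i))"
  shows "power_mean (ereal r) x w = m"
proof -
  define W where "W = (\<Sum>i<length x. w ! i)"
  have W: "0 < W" using mean_domD(4)[OF x] by (simp add: W_def)
  show ?thesis
  proof (cases "r = 0")
    case True
    have "(\<Prod>i<length x. (x ! i) powr (w ! i)) = exp (\<Sum>i<length x. w ! i * ln (x ! i))"
      using mean_domD(2)[OF x] by (fastforce simp: exp_sum powr_def intro!: prod.cong)
    also have "\<dots> = exp (W * ln m)"
      using eq True by (simp add: pow_fun_def W_def mult.commute)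
    finally show ?thesis
      using True W m by (simp add: power_mean_def flip: W_def) (simp add: powr_def)
  next
    case False
    have "(\<Sum>i<length x. w ! i * (x ! i) powr r) = m powr r * W"
      using eq False by (simp add: pow_fun_def W_def flip: sum_divide_distrib)
    then show ?thesis
      using False W m by (simp add: power_mean_def powr_powr flip: W_def)
  qed
qed

text \<open>\<open>average_attained\<close> yields a balance point in \<open>J\<close>, and
  \<open>power_mean_eqI\<close> identifies it as the power mean.\<close>

lemma power_mean_balance:
  fixes r :: real
  assumes x: "(x, w) \<in> mean_dom J" and J: "is_interval J" "J \<subseteq> {0<..}"
  defines "m \<equiv> power_mean (ereal r) x w"
  shows "m \<in> J" and "pow_fun r m * (\<Sum>i<length x. w ! i) = (\<Sum>i<length x. w ! i * pow_fun r (x ! i))"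
proof -
  obtain m' where m': "m' \<in> J"
    "pow_fun r m' * (\<Sum>i<length x. w ! i) = (\<Sum>i<length x. w ! i * pow_fun r (x ! i))"
    using average_attained[OF J(1) continuous_on_subset[OF pow_fun_continuous J(2)]
        monotone_on_subset[OF pow_fun_strict_mono J(2)] x] by blast
  then have "m = m'"
    using power_mean_eqI[of x w m' r] mean_dom_mono[OF J(2)] x J(2) by (auto simp: m_def)
  with m' show "m \<in> J"
    "pow_fun r m * (\<Sum>i<length x. w ! i) = (\<Sum>i<length x. w ! i * pow_fun r (x ! i))" by auto
qed

lemma mean_dom_scale:
  assumes "(x, w) \<in> mean_dom {0<..}" "0 < t"
  shows "(map ((*) t) x, w) \<in> mean_dom {0<..}"
  using assms by (auto simp: mean_dom_def tuples_def)

text \<open>Scaling by \<open>t\<close> adds \<open>ln t\<close> to the logarithm and multiplies the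
  other generators by \<open>t powr r\<close>, so \<open>t\<close> times the old mean balances the
  scaled tuple.\<close>

lemma power_mean_homogeneous:
  assumes x: "(x, w) \<in> mean_dom {0<..}" and t: "0 < t"
  shows "power_mean (ereal r) (map ((*) t) x) w = t * power_mean (ereal r) x w"
proof (rule power_mean_eqI[OF mean_dom_scale[OF x t]])
  have I: "is_interval {0::real<..}" by (simp add: is_interval_1)
  note b = power_mean_balance[OF x I subset_refl, of r]
  let ?m = "power_mean (ereal r) x w"
  show "0 < t * ?m" using b t by simp
  show "pow_fun r (t * ?m) * (\<Sum>i<length (map ((*) t) x). w ! i) =
      (\<Sum>i<length (map ((*) t) x). w ! i * pow_fun r (map ((*) t) x ! i))"
  proof (cases "r = 0")
    case True
    have "(\<Sum>i<length x. w ! i * ln (t * x ! i)) = (\<Sum>i<length x. ln t * w ! i + w ! i * ln (x ! i))"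
      using mean_domD(2)[OF x] t by (intro sum.cong) (auto simp: ln_mult_pos algebra_simps)
    also have "\<dots> = ln t * (\<Sum>i<length x. w ! i) + ln ?m * (\<Sum>i<length x. w ! i)"
      using b(2) True by (simp add: pow_fun_def sum.distrib sum_distrib_left)
    also have "\<dots> = ln (t * ?m) * (\<Sum>i<length x. w ! i)"
      using b(1) t by (simp add: ln_mult_pos distrib_right)
    finally show ?thesis
      using True by (simp add: pow_fun_def)
  next
    case False
    have "(\<Sum>i<length x. w ! i * ((t * x ! i) powr r / r)) =
        (\<Sum>i<length x. t powr r * (w ! i * pow_fun r (x ! i)))"
      using mean_domD(2)[OF x] t False
      by (intro sum.cong) (auto simp: powr_mult pow_fun_def)
    also have "\<dots> = t powr r * (pow_fun r ?m * (\<Sum>i<length x. w ! i))"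
      unfolding b(2) by (simp add: sum_distrib_left)
    also have "\<dots> = pow_fun r (t * ?m) * (\<Sum>i<length x. w ! i)"
      using b(1) t False by (simp add: pow_fun_def powr_mult)
    finally show ?thesis
      using False by (simp add: pow_fun_def)
  qed
qed

section \<open>Jensen's inequality relative to a power generator\<close>

text \<open>With \<open>c\<close> the value at \<open>m\<close> of the quotient of the derivatives of \<open>F\<close> and \<open>pow_fun r\<close>,
  which is monotone by the third assumption, \<open>F - c * pow_fun r\<close> is minimal at \<open>m\<close>.\<close>

lemma pow_fun_tangent:
  assumes F: "\<And>t. t \<in> {0<..<d} \<Longrightarrow> (F has_real_derivative F' t) (at t)"
    and F': "\<And>t. t \<in> {0<..<d} \<Longrightarrow> (F' has_real_derivative F'' t) (at t)"
    and pos: "\<And>t. t \<in> {0<..<d} \<Longrightarrow> 0 \<le> t * F'' t + (1 - r) * F' t"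
    and m: "m \<in> {0<..<d}" and y: "y \<in> {0<..<d}"
  shows "F' m * m powr (1 - r) * (pow_fun r y - pow_fun r m) \<le> F y - F m"
proof -
  define k where "k t = F' t * t powr (1 - r)" for t
  define \<phi> where "\<phi> t = F t - k m * pow_fun r t" for t
  have k_deriv: "(k has_real_derivative t powr (-r) * (t * F'' t + (1 - r) * F' t)) (at t)"
    if t: "t \<in> {0<..<d}" for t
  proof -
    have "t powr (1 - r) = t * t powr (-r)"
      using t by (simp add: powr_diff powr_minus field_simps)
    then show ?thesis
      unfolding k_def[abs_def] using t
      by (auto intro!: derivative_eq_intros F' simp: algebra_simps)
  qed
  have k_mono: "k a \<le> k b" if "a \<in> {0<..<d}" "b \<in> {0<..<d}" "a \<le> b" for a b
  proof (rule DERIV_nonneg_imp_nondecreasing[OF that(3)])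
    fix t assume "a \<le> t" "t \<le> b"
    then have t: "t \<in> {0<..<d}" using that by auto
    show "\<exists>D. (k has_real_derivative D) (at t) \<and> 0 \<le> D"
      using k_deriv[OF t] pos[OF t] by (meson mult_nonneg_nonneg powr_ge_zero)
  qed
  have phi_deriv: "(\<phi> has_real_derivative t powr (r - 1) * (k t - k m)) (at t)"
    if t: "t \<in> {0<..<d}" for t
  proof -
    have "k t * t powr (r - 1) = F' t"
      using t by (simp add: k_def flip: powr_add)
    then show ?thesis
      unfolding \<phi>_def[abs_def] using t
      by (auto intro!: derivative_eq_intros F pow_fun_deriv simp: algebra_simps)
  qed
  \<comment> \<open>Since \<open>k\<close> is nondecreasing, \<open>k t - k m\<close> makes the
    derivative of \<open>\<phi>\<close> nonpositive to the left of \<open>m\<close> and nonnegative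
    to the right.\<close>
  have "\<phi> m \<le> \<phi> y"
  proof (cases "m \<le> y")
    case True
    then show ?thesis
    proof (rule DERIV_nonneg_imp_nondecreasing)
      fix t assume "m \<le> t" "t \<le> y"
      then have t: "t \<in> {0<..<d}" and "0 \<le> k t - k m" using m y k_mono by auto
      then show "\<exists>D. (\<phi> has_real_derivative D) (at t) \<and> 0 \<le> D"
        using phi_deriv[OF t] by (meson mult_nonneg_nonneg powr_ge_zero)
    qed
  next
    case False
    then have "y \<le> m" by simp
    then show ?thesis
    proof (rule DERIV_nonpos_imp_nonincreasing)
      fix t assume "y \<le> t" "t \<le> m"
      then have t: "t \<in> {0<..<d}" and "k t - k m \<le> 0" using m y k_mono by auto
      then show "\<exists>D. (\<phi> has_real_derivative D) (at t) \<and> D \<le> 0"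
        using phi_deriv[OF t] by (meson mult_nonneg_nonpos powr_ge_zero)
    qed
  qed
  then show ?thesis by (simp add: \<phi>_def k_def algebra_simps)
qed

text \<open>The tangent inequalities at the power mean are summed with the weights; their left sides
  cancel by the balance equation. It is applied to \<open>f\<close> for the lower bound and to
  \<open>-f\<close> for the upper one.\<close>

lemma pow_fun_jensen:
  assumes F: "\<And>t. t \<in> {0<..<d} \<Longrightarrow> (F has_real_derivative F' t) (at t)"
    and F': "\<And>t. t \<in> {0<..<d} \<Longrightarrow> (F' has_real_derivative F'' t) (at t)"
    and pos: "\<And>t. t \<in> {0<..<d} \<Longrightarrow> 0 \<le> t * F'' t + (1 - r) * F' t"
    and x: "(x, w) \<in> mean_dom {0<..<d}"
  shows "F (power_mean (ereal r) x w) * (\<Sum>i<length x. w ! i) \<le> (\<Sum>i<length x. w ! i * F (x ! i))"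
proof -
  have I: "is_interval {0<..<d}" "{0<..<d} \<subseteq> {0<..}" by (auto simp: is_interval_oo)
  note b = power_mean_balance[OF x I, of r]
  let ?m = "power_mean (ereal r) x w"
  define c where "c = F' ?m * ?m powr (1 - r)"
  have "0 = c * ((\<Sum>i<length x. w ! i * pow_fun r (x ! i)) - pow_fun r ?m * (\<Sum>i<length x. w ! i))"
    using b by simp
  also have "\<dots> = (\<Sum>i<length x. w ! i * (c * (pow_fun r (x ! i) - pow_fun r ?m)))"
    by (simp add: sum_distrib_left sum_distrib_right algebra_simps sum_subtractf)
  also have "\<dots> \<le> (\<Sum>i<length x. w ! i * (F (x ! i) - F ?m))"
    unfolding c_def using mean_domD[OF x]
    by (intro sum_mono mult_left_mono pow_fun_tangent[OF F F' pos b(1)]) auto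
  finally show ?thesis
    by (simp add: algebra_simps sum_subtractf sum_distrib_left)
qed


section \<open>Dependence of the power mean on its exponent\<close>

text \<open>For \<open>s \<noteq> 0\<close> the mean is \<open>exp (ln (u s) / s)\<close> with
  \<open>u\<close> differentiable and positive, which is continuous away from 0. At 0 the exponent
  tends to the derivative of \<open>ln (u s)\<close>, the weighted average of the
  logarithms.\<close>

lemma power_mean_tendsto:
  assumes x: "(x, w) \<in> mean_dom {0<..}"
  shows "((\<lambda>s. power_mean (ereal s) x w) \<longlongrightarrow> power_mean (ereal r) x w) (at r)"
proof -
  define W where "W = (\<Sum>i<length x. w ! i)"
  define u where "u s = (\<Sum>i<length x. w ! i * (x ! i) powr s) / W" for s
  have W: "0 < W" using mean_domD(4)[OF x] by (simp add: W_def)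
  obtain i where i: "i < length x" "w ! i > 0"
    using mean_dom_support(2)[OF x] by auto
  have u_pos: "0 < u s" for s
  proof -
    have "0 < (\<Sum>i<length x. w ! i * (x ! i) powr s)"
      using mean_domD[OF x] i
      by (intro sum_pos2[of _ i]) (auto simp: less_imp_neq[symmetric])
    then show ?thesis using W by (simp add: u_def)
  qed
  have u_deriv: "(u has_real_derivative (\<Sum>i<length x. w ! i * ((x ! i) powr s * ln (x ! i))) / W) (at s)" for s
  proof -
    have "((\<lambda>s. (x ! i) powr s) has_real_derivative (x ! i) powr s * ln (x ! i)) (at s)"
      if "i < length x" for i
      using mean_domD(2)[OF x that] by (auto intro!: derivative_eq_intros)
    then show ?thesis
      unfolding u_def[abs_def] by (intro DERIV_cdivide DERIV_sum DERIV_cmult) auto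
  qed
  have eq: "power_mean (ereal s) x w = exp (ln (u s) / s)" if "s \<noteq> 0" for s
  proof -
    have "power_mean (ereal s) x w = u s powr (1 / s)"
      using that by (simp add: power_mean_def u_def W_def)
    then show ?thesis using u_pos[of s] by (simp add: powr_def)
  qed
  have ev: "\<forall>\<^sub>F s in at r. exp (ln (u s) / s) = power_mean (ereal s) x w"
    if "\<forall>\<^sub>F s in at r. s \<noteq> 0"
    using that by (rule eventually_mono) (simp add: eq)
  show ?thesis
  proof (cases "r = 0")
    case False
    have "isCont u r" using u_deriv DERIV_isCont by blast
    then have "((\<lambda>s. exp (ln (u s) / s)) \<longlongrightarrow> exp (ln (u r) / r)) (at r)"
      using False u_pos[of r] by (auto intro!: tendsto_intros simp: isCont_def)
    moreover have "\<forall>\<^sub>F s in at r. s \<noteq> 0"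
      using False by (intro tendsto_imp_eventually_ne[of "\<lambda>s. s" r]) auto
    ultimately show ?thesis
      using ev eq[OF False] Lim_transform_eventually by fastforce
  next
    case True
    define D where "D = (\<Sum>i<length x. w ! i * ln (x ! i)) / W"
    \<comment> \<open>Positivity of the entries matters here, since
      \<open>0 powr 0 = 0\<close>.\<close>
    have "(\<Sum>i<length x. w ! i * (x ! i) powr 0) = W"
      using mean_domD(2)[OF x] by (fastforce simp: W_def intro!: sum.cong)
    then have u0: "u 0 = 1" using W by (simp add: u_def)
    have "(\<Sum>i<length x. w ! i * ((x ! i) powr 0 * ln (x ! i))) / W = D"
      using mean_domD(2)[OF x] by (fastforce simp: D_def intro!: sum.cong)
    then have "((\<lambda>s. ln (u s)) has_real_derivative D) (at 0)"
      using DERIV_chain2[OF DERIV_ln u_deriv[of 0]] u0 by simp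
    \<comment> \<open>As \<open>u 0 = 1\<close>, the quotient \<open>ln (u s) / s\<close> is the
      difference quotient of \<open>ln (u s)\<close> at 0.\<close>
    then have "((\<lambda>s. exp (ln (u s) / s)) \<longlongrightarrow> exp D) (at 0)"
      by (intro tendsto_intros) (simp add: has_field_derivative_iff u0)
    moreover have "\<forall>\<^sub>F s in at (0::real). s \<noteq> 0"
      by (simp add: eventually_at_filter)
    moreover have "power_mean (ereal 0) x w = exp D"
    proof (rule power_mean_eqI[OF x])
      show "pow_fun 0 (exp D) * (\<Sum>i<length x. w ! i) = (\<Sum>i<length x. w ! i * pow_fun 0 (x ! i))"
        using W by (simp add: pow_fun_def D_def flip: W_def)
    qed simp
    ultimately show ?thesis
      using ev True Lim_transform_eventually by fastforce
  qed
qed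

text \<open>Only the term of index \<open>i\<close> is kept in the sum; raising to the power
  \<open>1 / s\<close> preserves the inequality for positive \<open>s\<close> and reverses it for
  negative \<open>s\<close>. The factor \<open>c powr (1 / s)\<close> tends to 1 as \<open>s\<close>
  tends to either infinity.\<close>

lemma power_mean_extreme_bounds:
  assumes x: "(x, w) \<in> mean_dom {0<..}" and i: "i < length x" "0 < w ! i"
  defines "c \<equiv> w ! i / (\<Sum>i<length x. w ! i)"
  shows "0 < s \<Longrightarrow> c powr (1 / s) * x ! i \<le> power_mean (ereal s) x w"
    and "s < 0 \<Longrightarrow> power_mean (ereal s) x w \<le> c powr (1 / s) * x ! i"
proof -
  define W where "W = (\<Sum>i<length x. w ! i)"
  have W: "0 < W" using mean_domD(4)[OF x] by (simp add: W_def)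
  have xi: "0 < x ! i" using mean_domD(2)[OF x i(1)] by simp
  have c: "0 < c" using W i by (simp add: c_def W_def)
  have "w ! i * (x ! i) powr s \<le> (\<Sum>i<length x. w ! i * (x ! i) powr s)"
    using mean_domD[OF x] i by (intro member_le_sum) auto
  then have le: "c * (x ! i) powr s \<le> (\<Sum>i<length x. w ! i * (x ! i) powr s) / W"
    using W by (simp add: c_def divide_right_mono flip: W_def)
  have eq: "c powr (1 / s) * x ! i = (c * (x ! i) powr s) powr (1 / s)" if "s \<noteq> 0"
    using that c xi by (simp add: powr_mult powr_powr)
  have pos: "0 < c * (x ! i) powr s" using c xi by simp
  show "c powr (1 / s) * x ! i \<le> power_mean (ereal s) x w" if "0 < s"
    using that pos powr_mono2[OF _ _ le, of "1 / s"] eq by (simp add: power_mean_def W_def)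
  show "power_mean (ereal s) x w \<le> c powr (1 / s) * x ! i" if "s < 0"
    using that pos powr_mono2'[OF _ _ le, of "1 / s"] eq by (simp add: power_mean_def W_def)
qed

text \<open>For finite \<open>p\<close> the exponent tends to \<open>p\<close> from the left. For
  \<open>p = \<infinity>\<close>, \<open>power_mean_extreme_bounds\<close> is applied at an index
  attaining the maximum. The value \<open>-\<infinity>\<close> is excluded because no real exponent
  lies below it.\<close>

lemma power_mean_le_limit:
  assumes x: "(x, w) \<in> mean_dom {0<..}" and p: "p \<noteq> -\<infinity>"
    and le: "\<And>r. ereal r < p \<Longrightarrow> ereal (power_mean (ereal r) x w) \<le> L"
  shows "ereal (power_mean p x w) \<le> L"
proof (cases p)
  case (real r)
  have "((\<lambda>s. ereal (power_mean (ereal s) x w)) \<longlongrightarrow> ereal (power_mean (ereal r) x w)) (at_left r)"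
    using power_mean_tendsto[OF x, of r] by (auto intro: filterlim_mono[OF _ order_refl] at_le)
  moreover have "\<forall>\<^sub>F s in at_left r. ereal (power_mean (ereal s) x w) \<le> L"
    using le real by (auto simp: eventually_at_filter)
  ultimately show ?thesis
    unfolding real by (rule tendsto_upperbound) simp
next
  case PInf
  define S where "S = {x ! i | i. i < length x \<and> w ! i > 0}"
  have "Max S \<in> {x ! i | i. i < length x \<and> w ! i > 0}"
    unfolding S_def using mean_dom_support[OF x] by (intro Max_in)
  then obtain i where i: "i < length x" "0 < w ! i" "Max S = x ! i" by blast
  define c where "c = w ! i / (\<Sum>i<length x. w ! i)"
  have "0 < c" using mean_domD(4)[OF x] i by (simp add: c_def)
  have "((\<lambda>s::real. 1 / s) \<longlongrightarrow> 0) at_top"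
    by (rule tendsto_divide_0[OF tendsto_const filterlim_mono[OF filterlim_ident at_top_le_at_infinity order_refl]])
  then have "((\<lambda>s. c powr (1 / s) * x ! i) \<longlongrightarrow> c powr 0 * x ! i) at_top"
    using \<open>0 < c\<close> by (intro tendsto_mult tendsto_powr tendsto_const) auto
  then have "((\<lambda>s. ereal (c powr (1 / s) * x ! i)) \<longlongrightarrow> ereal (x ! i)) at_top"
    using \<open>0 < c\<close> by simp
  moreover have "\<forall>\<^sub>F s in at_top. ereal (c powr (1 / s) * x ! i) \<le> L"
    using eventually_gt_at_top[of 0]
  proof eventually_elim
    case (elim s)
    then have "ereal (c powr (1 / s) * x ! i) \<le> ereal (power_mean (ereal s) x w)"
      using power_mean_extreme_bounds(1)[OF x i(1,2)] by (simp add: c_def)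
    also have "\<dots> \<le> L" using le PInf by simp
    finally show ?case .
  qed
  ultimately have "ereal (x ! i) \<le> L" by (rule tendsto_upperbound) simp
  then show ?thesis using PInf i(3) by (simp add: power_mean_def S_def)
qed (use p in auto)

text \<open>Dual to \<open>power_mean_le_limit\<close>: the exponent tends to \<open>p\<close> from
  the right, or to \<open>-\<infinity>\<close> with an index attaining the minimum.\<close>

lemma power_mean_ge_limit:
  assumes x: "(x, w) \<in> mean_dom {0<..}" and p: "p \<noteq> \<infinity>"
    and ge: "\<And>r. p < ereal r \<Longrightarrow> L \<le> ereal (power_mean (ereal r) x w)"
  shows "L \<le> ereal (power_mean p x w)"
proof (cases p)
  case (real r)
  have "((\<lambda>s. ereal (power_mean (ereal s) x w)) \<longlongrightarrow> ereal (power_mean (ereal r) x w)) (at_right r)"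
    using power_mean_tendsto[OF x, of r] by (auto intro: filterlim_mono[OF _ order_refl] at_le)
  moreover have "\<forall>\<^sub>F s in at_right r. L \<le> ereal (power_mean (ereal s) x w)"
    using ge real by (auto simp: eventually_at_filter)
  ultimately show ?thesis
    unfolding real by (rule tendsto_lowerbound) simp
next
  case MInf
  define S where "S = {x ! i | i. i < length x \<and> w ! i > 0}"
  have "Min S \<in> {x ! i | i. i < length x \<and> w ! i > 0}"
    unfolding S_def using mean_dom_support[OF x] by (intro Min_in)
  then obtain i where i: "i < length x" "0 < w ! i" "Min S = x ! i" by blast
  define c where "c = w ! i / (\<Sum>i<length x. w ! i)"
  have "0 < c" using mean_domD(4)[OF x] i by (simp add: c_def)
  have "((\<lambda>s::real. 1 / s) \<longlongrightarrow> 0) at_bot"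
    by (rule tendsto_divide_0[OF tendsto_const filterlim_mono[OF filterlim_ident at_bot_le_at_infinity order_refl]])
  then have "((\<lambda>s. c powr (1 / s) * x ! i) \<longlongrightarrow> c powr 0 * x ! i) at_bot"
    using \<open>0 < c\<close> by (intro tendsto_mult tendsto_powr tendsto_const) auto
  then have "((\<lambda>s. ereal (c powr (1 / s) * x ! i)) \<longlongrightarrow> ereal (x ! i)) at_bot"
    using \<open>0 < c\<close> by simp
  moreover have "\<forall>\<^sub>F s in at_bot. L \<le> ereal (c powr (1 / s) * x ! i)"
    using eventually_gt_at_bot[of 0]
  proof eventually_elim
    case (elim s)
    have "L \<le> ereal (power_mean (ereal s) x w)" using ge MInf by simp
    also have "\<dots> \<le> ereal (c powr (1 / s) * x ! i)"
      using elim power_mean_extreme_bounds(2)[OF x i(1,2)] by (simp add: c_def)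
    finally show ?case .
  qed
  ultimately have "L \<le> ereal (x ! i)" by (rule tendsto_lowerbound) simp
  then show ?thesis using MInf i(3) by (simp add: power_mean_def S_def)
qed (use p in auto)

text \<open>Multiplication by a positive \<open>t\<close> is monotone and so commutes with
  \<open>Min\<close> and \<open>Max\<close>. This complements \<open>power_mean_homogeneous\<close>,
  which covers real exponents.\<close>

lemma power_mean_infinite_homogeneous:
  assumes x: "(x, w) \<in> mean_dom {0<..}" and t: "0 < t"
  shows "power_mean (-\<infinity>) (map ((*) t) x) w = t * power_mean (-\<infinity>) x w"
    and "power_mean \<infinity> (map ((*) t) x) w = t * power_mean \<infinity> x w"
proof -
  define S where "S = {x ! i | i. i < length x \<and> w ! i > 0}"
  have S: "finite S" "S \<noteq> {}"
    using mean_dom_support[OF x] by (simp_all add: S_def)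
  have img: "{map ((*) t) x ! i | i. i < length (map ((*) t) x) \<and> w ! i > 0} = (*) t ` S"
    by (force simp: S_def)
  have "mono ((*) t)" using t by (simp add: mono_def mult_left_mono)
  then show "power_mean (-\<infinity>) (map ((*) t) x) w = t * power_mean (-\<infinity>) x w"
    "power_mean \<infinity> (map ((*) t) x) w = t * power_mean \<infinity> x w"
    unfolding power_mean_def img
    using S by (simp_all add: mono_Min_commute mono_Max_commute S_def)
qed

section \<open>Quasiarithmetic means and scaled tuples\<close>

text \<open>Counterpart of \<open>power_mean_eqI\<close>. The inverse in \<open>qa_mean\<close> is
  taken on all of \<open>I\<close>, so injectivity is required there even when the tuple lies in a
  small subinterval.\<close>

lemma qa_mean_eqI:
  assumes "inj_on f I" "m \<in> I" "(x, w) \<in> mean_dom J"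
    and "f m * (\<Sum>i<length x. w ! i) = (\<Sum>i<length x. w ! i * f (x ! i))"
  shows "qa_mean I f x w = m"
proof -
  have "(\<Sum>i<length x. w ! i * f (x ! i)) / (\<Sum>i<length x. w ! i) = f m"
    using assms(4) mean_domD(4)[OF assms(3)] by (simp add: field_simps)
  then show ?thesis using assms(1,2) by (simp add: qa_mean_def the_inv_into_f_f)
qed

text \<open>The signs of the function and of the average cancel; a decreasing \<open>f\<close> may
  therefore be replaced by \<open>-f\<close>.\<close>

lemma qa_mean_uminus: "qa_mean I (\<lambda>t. - f t) = qa_mean I f"
  by (intro ext) (simp add: qa_mean_def the_inv_into_def sum_negf)

lemma eventually_scale_mean_dom:
  assumes x: "(x, w) \<in> mean_dom {0<..}" and d: "0 < d"
  shows "\<forall>\<^sub>F t in at_right 0. (map ((*) t) x, w) \<in> mean_dom {0<..<d}"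
proof -
  have "\<forall>\<^sub>F t in at_right 0. 0 < t \<and> (\<forall>a\<in>set x. t * a < d)"
  proof (intro eventually_conj eventually_ball_finite ballI)
    show "\<forall>\<^sub>F t in at_right (0::real). 0 < t" by (simp add: eventually_at_filter)
    fix a assume "a \<in> set x"
    have "((\<lambda>t. t * a) \<longlongrightarrow> 0 * a) (at_right 0)" by (intro tendsto_intros)
    then show "\<forall>\<^sub>F t in at_right 0. t * a < d" using d by (auto dest: order_tendstoD(2))
  qed simp
  then show ?thesis
    by eventually_elim (use x in \<open>force simp: mean_dom_def tuples_def\<close>)
qed

section \<open>Homogenization bounds for an increasing generator\<close>

text \<open>Analysis takes place on the open interval \<open>{0<..<b}\<close>, where derivatives are
  two-sided; \<open>I\<close> enters only through the inverse of \<open>f\<close>. The locale is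
  interpreted with \<open>f\<close> or with \<open>-f\<close>, depending on the sign of the
  derivative.\<close>

locale increasing_generator =
  fixes I :: "real set" and f f' f'' :: "real \<Rightarrow> real" and b :: real
  assumes b: "0 < b" "{0<..<b} \<subseteq> I"
    and inj: "inj_on f I"
    and deriv: "t \<in> {0<..<b} \<Longrightarrow> (f has_real_derivative f' t) (at t)"
    and deriv2: "t \<in> {0<..<b} \<Longrightarrow> (f' has_real_derivative f'' t) (at t)"
    and deriv_pos: "t \<in> {0<..<b} \<Longrightarrow> 0 < f' t"
begin

lemma strict_mono: "strict_mono_on {0<..<b} f"
proof (rule strict_mono_onI)
  fix s t assume st: "s \<in> {0<..<b}" "t \<in> {0<..<b}" "s < t"
  show "f s < f t"
  proof (rule DERIV_pos_imp_increasing[OF st(3)])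
    fix z assume "s \<le> z" "z \<le> t"
    then have "z \<in> {0<..<b}" using st by simp
    then show "\<exists>D. (f has_real_derivative D) (at z) \<and> 0 < D"
      using deriv deriv_pos by blast
  qed
qed

text \<open>\<open>average_attained\<close> gives a balance point in \<open>{0<..<b}\<close>, and
  injectivity on \<open>I\<close> identifies it with the mean.\<close>

lemma qa_mean_balance:
  assumes x: "(x, w) \<in> mean_dom {0<..<b}"
  defines "m \<equiv> qa_mean I f x w"
  shows "m \<in> {0<..<b}"
    and "f m * (\<Sum>i<length x. w ! i) = (\<Sum>i<length x. w ! i * f (x ! i))"
    and "power_mean (-\<infinity>) x w \<le> m" and "m \<le> power_mean \<infinity> x w"
proof -
  have "continuous_on {0<..<b} f"
    by (rule DERIV_continuous_on[OF has_field_derivative_at_within[OF deriv]])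
  then obtain m' where m': "m' \<in> {0<..<b}"
    "f m' * (\<Sum>i<length x. w ! i) = (\<Sum>i<length x. w ! i * f (x ! i))"
    "power_mean (-\<infinity>) x w \<le> m'" "m' \<le> power_mean \<infinity> x w"
    using average_attained[OF is_interval_oo _ strict_mono x] by blast
  moreover have "m = m'"
    unfolding m_def using m' b by (intro qa_mean_eqI[OF inj _ x]) auto
  ultimately show "m \<in> {0<..<b}"
    "f m * (\<Sum>i<length x. w ! i) = (\<Sum>i<length x. w ! i * f (x ! i))"
    "power_mean (-\<infinity>) x w \<le> m" "m \<le> power_mean \<infinity> x w" by auto
qed

text \<open>Multiplication by the positive \<open>f' t\<close> clears the denominator of
  \<open>chi\<close> and produces the expression whose sign \<open>pow_fun_jensen\<close>
  requires.\<close>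

lemma chi_ge_iff: "t \<in> {0<..<b} \<Longrightarrow> r \<le> chi f' f'' t \<longleftrightarrow> 0 \<le> t * f'' t + (1 - r) * f' t"
  and chi_le_iff: "t \<in> {0<..<b} \<Longrightarrow> chi f' f'' t \<le> r \<longleftrightarrow> t * f'' t + (1 - r) * f' t \<le> 0"
  using deriv_pos[of t] by (simp_all add: chi_def field_simps)

text \<open>By Jensen and the balance equation, \<open>f\<close> at the power mean is at most
  \<open>f\<close> at the quasiarithmetic mean; strict monotonicity removes
  \<open>f\<close>.\<close>

lemma power_mean_le_qa_mean:
  assumes x: "(x, w) \<in> mean_dom {0<..<d}" and d: "d \<le> b"
    and chi: "\<And>t. t \<in> {0<..<d} \<Longrightarrow> r \<le> chi f' f'' t"
  shows "power_mean (ereal r) x w \<le> qa_mean I f x w"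
proof -
  have "{0<..<d} \<subseteq> {0<..<b}" using d by auto
  then have xb: "(x, w) \<in> mean_dom {0<..<b}" using x mean_dom_mono by blast
  note q = qa_mean_balance[OF xb]
  have m: "power_mean (ereal r) x w \<in> {0<..<b}"
    by (rule power_mean_balance(1)[OF xb]) (auto simp: is_interval_oo)
  have "f (power_mean (ereal r) x w) * (\<Sum>i<length x. w ! i) \<le> (\<Sum>i<length x. w ! i * f (x ! i))"
  proof (rule pow_fun_jensen[where d = d and F' = f' and F'' = f''])
    fix t assume "t \<in> {0<..<d}"
    then show "0 \<le> t * f'' t + (1 - r) * f' t"
      using chi chi_ge_iff d by auto
  qed (use x d in \<open>auto intro!: deriv deriv2\<close>)
  then have "f (power_mean (ereal r) x w) \<le> f (qa_mean I f x w)"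
    using q(2) mean_domD(4)[OF x] by (metis mult_le_cancel_right_pos)
  then show ?thesis
    using strict_mono_on_less_eq[OF strict_mono m q(1)] by simp
qed

lemma qa_mean_le_power_mean:
  assumes x: "(x, w) \<in> mean_dom {0<..<d}" and d: "d \<le> b"
    and chi: "\<And>t. t \<in> {0<..<d} \<Longrightarrow> chi f' f'' t \<le> r"
  shows "qa_mean I f x w \<le> power_mean (ereal r) x w"
proof -
  have "{0<..<d} \<subseteq> {0<..<b}" using d by auto
  then have xb: "(x, w) \<in> mean_dom {0<..<b}" using x mean_dom_mono by blast
  note q = qa_mean_balance[OF xb]
  have m: "power_mean (ereal r) x w \<in> {0<..<b}"
    by (rule power_mean_balance(1)[OF xb]) (auto simp: is_interval_oo)
  have "- f (power_mean (ereal r) x w) * (\<Sum>i<length x. w ! i) \<le> (\<Sum>i<length x. w ! i * - f (x ! i))"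
  \<comment> \<open>Jensen's inequality for \<open>-f\<close>, whose sign condition is the reversed
    bound on \<open>chi\<close>.\<close>
  proof (rule pow_fun_jensen[where d = d and F' = "\<lambda>t. - f' t" and F'' = "\<lambda>t. - f'' t"])
    fix t assume t: "t \<in> {0<..<d}"
    then have "t * f'' t + (1 - r) * f' t \<le> 0"
      using chi chi_le_iff d by auto
    then show "0 \<le> t * - f'' t + (1 - r) * - f' t" by (simp add: algebra_simps)
  qed (use x d in \<open>auto intro!: derivative_intros deriv deriv2\<close>)
  then have "f (qa_mean I f x w) * (\<Sum>i<length x. w ! i)
      \<le> f (power_mean (ereal r) x w) * (\<Sum>i<length x. w ! i)"
    using q(2) by (simp add: sum_negf)
  then have "f (qa_mean I f x w) \<le> f (power_mean (ereal r) x w)"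
    using mean_domD(4)[OF x] by (metis mult_le_cancel_right_pos)
  then show ?thesis
    using strict_mono_on_less_eq[OF strict_mono q(1) m] by simp
qed

lemma power_mean_Liminf_le_lower_homog:
  assumes x: "(x, w) \<in> mean_dom {0<..}"
  defines "p \<equiv> Liminf (at_right 0) (\<lambda>t. ereal (chi f' f'' t))"
  shows "ereal (power_mean p x w) \<le> lower_homog (qa_mean I f) x w"
\<comment> \<open>No real \<open>r\<close> lies below \<open>-\<infinity>\<close>, so that case
  rests on the bound of the mean by the smallest entry of positive weight. Otherwise each real
  \<open>r < p\<close> bounds \<open>chi\<close> from below near 0.\<close>
proof (cases "p = -\<infinity>")
  case True
  have "\<forall>\<^sub>F t in at_right 0. ereal (power_mean p x w) \<le> ereal (1 / t * qa_mean I f (map ((*) t) x) w)"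
    using eventually_scale_mean_dom[OF x b(1)] eventually_at_right_less[of 0]
  proof eventually_elim
    case (elim t)
    then show ?case
      using qa_mean_balance(3)[OF elim(1)] power_mean_infinite_homogeneous(1)[OF x elim(2)] True
      by (simp add: field_simps)
  qed
  then show ?thesis unfolding lower_homog_def by (rule Liminf_bounded)
next
  case False
  then show ?thesis
  proof (rule power_mean_le_limit[OF x])
    fix r assume "ereal r < p"
    then have "\<forall>\<^sub>F t in at_right 0. ereal r < ereal (chi f' f'' t)"
      unfolding p_def by (rule less_LiminfD)
    then obtain e where e: "0 < e" "\<And>t. 0 < t \<Longrightarrow> t < e \<Longrightarrow> r < chi f' f'' t"
      unfolding eventually_at_right_field by auto
    define d where "d = min e b"
    have d: "0 < d" "d \<le> b" "\<And>t. t \<in> {0<..<d} \<Longrightarrow> r \<le> chi f' f'' t"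
      using e b by (auto simp: d_def less_imp_le)
    have "\<forall>\<^sub>F t in at_right 0.
        ereal (power_mean (ereal r) x w) \<le> ereal (1 / t * qa_mean I f (map ((*) t) x) w)"
      using eventually_scale_mean_dom[OF x d(1)] eventually_at_right_less[of 0]
    proof eventually_elim
      case (elim t)
      then show ?case
        using power_mean_le_qa_mean[OF elim(1) d(2,3)] power_mean_homogeneous[OF x elim(2)]
        by (simp add: field_simps)
    qed
    then show "ereal (power_mean (ereal r) x w) \<le> lower_homog (qa_mean I f) x w"
      unfolding lower_homog_def by (rule Liminf_bounded)
  qed
qed

lemma upper_homog_le_power_mean_Limsup:
  assumes x: "(x, w) \<in> mean_dom {0<..}"
  defines "q \<equiv> Limsup (at_right 0) (\<lambda>t. ereal (chi f' f'' t))"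
  shows "upper_homog (qa_mean I f) x w \<le> ereal (power_mean q x w)"
\<comment> \<open>Here the bound by the greatest entry of positive weight replaces the approximation
  by real \<open>r > q\<close>.\<close>
proof (cases "q = \<infinity>")
  case True
  have "\<forall>\<^sub>F t in at_right 0. ereal (1 / t * qa_mean I f (map ((*) t) x) w) \<le> ereal (power_mean q x w)"
    using eventually_scale_mean_dom[OF x b(1)] eventually_at_right_less[of 0]
  proof eventually_elim
    case (elim t)
    then show ?case
      using qa_mean_balance(4)[OF elim(1)] power_mean_infinite_homogeneous(2)[OF x elim(2)] True
      by (simp add: field_simps)
  qed
  then show ?thesis unfolding upper_homog_def by (rule Limsup_bounded)
next
  case False
  then show ?thesis
  proof (rule power_mean_ge_limit[OF x])
    fix r assume "q < ereal r"
    then have "\<forall>\<^sub>F t in at_right 0. ereal (chi f' f'' t) < ereal r"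
      unfolding q_def by (rule Limsup_lessD)
    then obtain e where e: "0 < e" "\<And>t. 0 < t \<Longrightarrow> t < e \<Longrightarrow> chi f' f'' t < r"
      unfolding eventually_at_right_field by auto
    define d where "d = min e b"
    have d: "0 < d" "d \<le> b" "\<And>t. t \<in> {0<..<d} \<Longrightarrow> chi f' f'' t \<le> r"
      using e b by (auto simp: d_def less_imp_le)
    have "\<forall>\<^sub>F t in at_right 0.
        ereal (1 / t * qa_mean I f (map ((*) t) x) w) \<le> ereal (power_mean (ereal r) x w)"
      using eventually_scale_mean_dom[OF x d(1)] eventually_at_right_less[of 0]
    proof eventually_elim
      case (elim t)
      then show ?case
        using qa_mean_le_power_mean[OF elim(1) d(2,3)] power_mean_homogeneous[OF x elim(2)]
        by (simp add: field_simps)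
    qed
    then show "upper_homog (qa_mean I f) x w \<le> ereal (power_mean (ereal r) x w)"
      unfolding upper_homog_def by (rule Limsup_bounded)
  qed
qed

end

section \<open>Reduction to an increasing generator\<close>

text \<open>Two equal values would give a zero of \<open>f'\<close> by Rolle's theorem. Derivatives
  within \<open>I\<close> may be one-sided at an endpoint, but become two-sided strictly between
  \<open>s\<close> and \<open>t\<close>.\<close>

lemma inj_on_interval_deriv_nonzero:
  fixes f f' :: "real \<Rightarrow> real"
  assumes I: "is_interval I"
    and f: "\<And>t. t \<in> I \<Longrightarrow> (f has_real_derivative f' t) (at t within I)"
    and nz: "\<And>t. t \<in> I \<Longrightarrow> f' t \<noteq> 0"
  shows "inj_on f I"
proof (rule linorder_inj_onI)
  fix s t assume st: "s < t" "s \<in> I" "t \<in> I"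
  have sub: "{s..t} \<subseteq> I" using I st by (meson atLeastAtMost_iff mem_is_interval_1_I subsetI)
  show "f s \<noteq> f t"
  proof
    assume eq: "f s = f t"
    have d: "(f has_real_derivative f' z) (at z)" if "s < z" "z < t" for z
    proof -
      have "z \<in> I" "{s<..<t} \<subseteq> I" using sub that by auto
      then have "(f has_real_derivative f' z) (at z within {s<..<t})"
        by (rule has_field_derivative_subset[OF f])
      then show ?thesis
        using at_within_open[of z "{s<..<t}"] that by simp
    qed
    have "continuous_on I f"
      by (rule DERIV_continuous_on[OF f])
    then have cont: "continuous_on {s..t} f"
      using sub by (rule continuous_on_subset)
    have deriv: "(f has_derivative (*) (f' z)) (at z)" if "s < z" "z < t" for z
      using d[OF that] by (rule has_field_derivative_imp_has_derivative)
    obtain z where z: "s < z" "z < t" "(*) (f' z) = (\<lambda>v. 0)"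
      using Rolle_deriv[where f' = "\<lambda>z. (*) (f' z)", OF st(1) eq cont deriv] by blast
    have "f' z = 0" using fun_cong[OF z(3), of 1] by simp
    moreover have "z \<in> I" using sub z(1,2) by (simp add: subset_eq)
    ultimately show False using nz by blast
  qed
qed auto


text \<open>Being differentiable, \<open>f'\<close> is continuous, so its image of the interval is
  connected and cannot meet both sides of 0 without containing 0.\<close>

lemma nonvanishing_deriv_sign:
  fixes f' f'' :: "real \<Rightarrow> real"
  assumes f': "\<And>t. t \<in> {0<..<b} \<Longrightarrow> (f' has_real_derivative f'' t) (at t)"
    and nz: "\<And>t. t \<in> {0<..<b} \<Longrightarrow> f' t \<noteq> 0"
  shows "(\<forall>t\<in>{0<..<b}. 0 < f' t) \<or> (\<forall>t\<in>{0<..<b}. f' t < 0)"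
proof (rule ccontr)
  assume "\<not> ?thesis"
  then obtain s t where "s \<in> {0<..<b}" "t \<in> {0<..<b}" "f' s \<le> 0" "0 \<le> f' t"
    by (auto simp: not_less)
  moreover have "connected (f' ` {0<..<b})"
    by (intro connected_continuous_image DERIV_continuous_on[OF has_field_derivative_at_within[OF f']]) auto
  ultimately have "0 \<in> f' ` {0<..<b}"
    by (meson connectedD_interval imageI)
  then show False using nz by auto
qed

lemma lower_homog_le_upper_homog: "lower_homog M x w \<le> upper_homog M x w"
  unfolding lower_homog_def upper_homog_def by (rule Liminf_le_Limsup) simp

theorem theorem3p2:
  fixes I :: "real set" and f f' f'' :: "real \<Rightarrow> real" and p q :: ereal
  assumes "is_interval I" and "I \<noteq> {}" and "I \<subseteq> {0<..}" and "Inf I = 0"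
    and "\<And>t. t \<in> I \<Longrightarrow> (f has_real_derivative f' t) (at t within I)"
    and "\<And>t. t \<in> I \<Longrightarrow> (f' has_real_derivative f'' t) (at t within I)"
    and "\<And>t. t \<in> I \<Longrightarrow> f' t \<noteq> 0"
    and "p = Liminf (at_right 0) (\<lambda>t. ereal (chi f' f'' t))"
    and "q = Limsup (at_right 0) (\<lambda>t. ereal (chi f' f'' t))"
  shows "(\<forall>(x, w) \<in> mean_dom {0<..}.
            ereal (power_mean p x w) \<le> lower_homog (qa_mean I f) x w \<and>
            upper_homog (qa_mean I f) x w \<le> ereal (power_mean q x w)) \<and>
         ((\<exists>L::ereal. ((\<lambda>t. ereal (chi f' f'' t)) \<longlongrightarrow> L) (at_right 0)) \<longrightarrow>
          (\<forall>(x, w) \<in> mean_dom {0<..}.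
            lower_homog (qa_mean I f) x w = upper_homog (qa_mean I f) x w \<and>
            upper_homog (qa_mean I f) x w = ereal (power_mean p x w) \<and>
            power_mean p x w = power_mean q x w))"
proof -
  obtain b where b: "b \<in> I" using assms(2) by auto
  have b_pos: "0 < b" using b assms(3) by auto
  \<comment> \<open>Because \<open>Inf I = 0\<close>, some point of \<open>I\<close> lies below
    \<open>t\<close>; since \<open>b\<close> lies above, the interval \<open>I\<close> contains
    \<open>t\<close>.\<close>
  have sub: "{0<..<b} \<subseteq> I"
  proof
    fix t assume t: "t \<in> {0<..<b}"
    then have "Inf I < t" using assms(4) by simp
    then obtain s where "s \<in> I" "s < t" using cInf_lessD[OF assms(2)] by blast
    then show "t \<in> I" using mem_is_interval_1_I[OF assms(1) _ b, of s t] t by simp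
  qed
  have local_deriv: "(g has_real_derivative g' t) (at t)"
    if "\<And>t. t \<in> I \<Longrightarrow> (g has_real_derivative g' t) (at t within I)" and t: "t \<in> {0<..<b}"
    for g g' :: "real \<Rightarrow> real" and t
  proof -
    have "(g has_real_derivative g' t) (at t within {0<..<b})"
      using that sub by (meson has_field_derivative_subset subsetD)
    then show ?thesis by (simp only: at_within_open[OF t open_greaterThanLessThan])
  qed
  note d = local_deriv[OF assms(5)] local_deriv[OF assms(6)]
  have inj: "inj_on f I"
    using assms(1,5,7) by (rule inj_on_interval_deriv_nonzero)
  have sandwich: "ereal (power_mean p x w) \<le> lower_homog (qa_mean I f) x w \<and>
      upper_homog (qa_mean I f) x w \<le> ereal (power_mean q x w)"
    if x: "(x, w) \<in> mean_dom {0<..}" for x w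
  proof -
    from nonvanishing_deriv_sign[OF d(2)] assms(7) sub
    consider "\<forall>t\<in>{0<..<b}. 0 < f' t" | "\<forall>t\<in>{0<..<b}. f' t < 0" by blast
    then show ?thesis
    proof cases
      case 1
      then interpret increasing_generator I f f' f'' b
        using b_pos sub inj d by unfold_locales auto
      show ?thesis
        using power_mean_Liminf_le_lower_homog[OF x] upper_homog_le_power_mean_Limsup[OF x]
        by (simp add: assms(8,9))
    next
      case 2
      then interpret increasing_generator I "\<lambda>t. - f t" "\<lambda>t. - f' t" "\<lambda>t. - f'' t" b
        using b_pos sub inj
        by unfold_locales (auto simp: inj_on_def intro!: DERIV_minus d)
      \<comment> \<open>Passing to \<open>-f\<close> changes neither \<open>chi\<close> nor the
        mean, so the bounds transfer to \<open>f\<close>.\<close>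
      have "chi (\<lambda>t. - f' t) (\<lambda>t. - f'' t) = chi f' f''" by (simp add: chi_def fun_eq_iff)
      then show ?thesis
        using power_mean_Liminf_le_lower_homog[OF x] upper_homog_le_power_mean_Limsup[OF x]
        by (simp add: assms(8,9) qa_mean_uminus)
    qed
  qed
  have "p = q" if "((\<lambda>t. ereal (chi f' f'' t)) \<longlongrightarrow> L) (at_right 0)" for L
    using lim_imp_Liminf[OF _ that] lim_imp_Limsup[OF _ that] by (simp add: assms(8,9))
  \<comment> \<open>For \<open>p = q\<close> the chain from the power mean of exponent
    \<open>p\<close> through both homogenizations to that of exponent \<open>q\<close> has equal
    ends and collapses.\<close>
  moreover have "lower_homog (qa_mean I f) x w = upper_homog (qa_mean I f) x w \<and>
      upper_homog (qa_mean I f) x w = ereal (power_mean p x w) \<and> power_mean p x w = power_mean q x w"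
    if "p = q" and x: "(x, w) \<in> mean_dom {0<..}" for x w
    using sandwich[OF x] lower_homog_le_upper_homog[of "qa_mean I f" x w] \<open>p = q\<close>
    by (metis antisym order_trans)
  ultimately show ?thesis using sandwich by blast
qed

end
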